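(* For every integer $K\ge 2$ define $$\mathcal{O}(K)=\left[1-\frac{1}{K-1}\sum_{l=2}^{K-1}\frac{K-l}{l^2-1}\right]^{-1},\qquad \mathcal{O}_1(K)=\lfloor 2\mathcal{O}(K)\rfloor,\qquad \mathcal{O}_2(K)=\lceil 2\mathcal{O}(K)\rceil,$$ and $$d_s(K)=\max_{i=1,2}\ \frac{\mathcal{O}_i(K)^2}{1+\dfrac{\mathcal{O}_i(K)\,(\mathcal{O}_i(K)-1)}{\mathcal{O}(K)}}.$$ Then $$\lim_{K\to\infty} d_s(K)=\frac{64}{15}.$$
   Context: The sum in the definition of $\mathcal{O}(K)$ is empty (equal to $0$) when $K=2$. $\lfloor\cdot\rfloor$ and $\lceil\cdot\rceil$ denote the floor and the ceiling. (The quantity $d_s(K)$ is the sum degrees-of-freedom achieved in the paper for the $K$-user MISO interference channel with completely outdated local channel knowledge at the transmitters; this interpretation is not needed for the claim.) *)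

theory Defs
  imports Complex_Main
begin

(* The functions below are intended for K \<ge> 2; their values at K = 0 and K = 1 are
   artefacts of totality and do not affect the limit. *)

definition Ord :: "nat \<Rightarrow> real" where
  "Ord K = inverse (1 - 1 / (real K - 1) *
     (\<Sum>l = 2..K - 1. (real K - real l) / ((real l)\<^sup>2 - 1)))"

definition Ord1 :: "nat \<Rightarrow> int" where
  "Ord1 K = \<lfloor>2 * Ord K\<rfloor>"

definition Ord2 :: "nat \<Rightarrow> int" where
  "Ord2 K = \<lceil>2 * Ord K\<rceil>"

definition dof_term :: "nat \<Rightarrow> int \<Rightarrow> real" where
  "dof_term K m = (real_of_int m)\<^sup>2 /
     (1 + real_of_int m * (real_of_int m - 1) / Ord K)"

definition d_s :: "nat \<Rightarrow> real" where
  "d_s K = max (dof_term K (Ord1 K)) (dof_term K (Ord2 K))"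

end

theory Submission
  imports Defs
begin

text \<open>
  The increments of \<open>T(K) = (\<Sum>l = 2..K-1. (K - l) / (l\<^sup>2 - 1))\<close> are telescoping sums with limit
  \<open>3/4\<close>, and the error \<open>3/4 (K - 1) - T(K)\<close> grows only logarithmically; hence \<open>Ord K\<close> tends
  to 4. Thus eventually one of the two roundings of \<open>2 * Ord K\<close> is 8 and the other lies in
  \<open>{7, 8, 9}\<close>. In the limit \<open>m = 7, 8, 9\<close> give \<open>98/23\<close>, \<open>64/15\<close>, \<open>81/19\<close>, of which \<open>64/15\<close> is
  the largest.
\<close>

text \<open>Partial fractions: \<open>1 / (l\<^sup>2 - 1)\<close> is half of
  \<open>1 / (l - 1) - 1 / (l + 1)\<close>, so only the boundary terms survive.\<close>

lemma sum_inverse_square_minus_one: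
  assumes "n \<ge> 1"
  shows "(\<Sum>l = 2..n. 1 / ((real l)\<^sup>2 - 1)) = 3/4 - 1 / (2 * real n) - 1 / (2 * (real n + 1))"
  using assms
proof (induction n rule: dec_induct)
  case base
  show ?case by simp
next
  case (step n)
  have pos: "real n > 0" using step by simp
  have "(real (Suc n))\<^sup>2 - 1 = real n * (real n + 2)"
    by (simp add: power2_eq_square algebra_simps)
  moreover have "1 / (real n * (real n + 2)) = 1 / (2 * real n) - 1 / (2 * (real n + 2))"
    using pos by (simp add: divide_simps)
  moreover have "{2..Suc n} = insert (Suc n) {2..n}"
    using step by auto
  ultimately show ?case
    using step.IH by (simp add: add_ac)
qed

text \<open>This is \<open>ln x \<le> x - 1\<close> at \<open>x = n / (n + 1)\<close>; it lets
  harmonic increments telescope into a logarithm.\<close>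

lemma one_div_Suc_le_ln_diff:
  assumes "n \<ge> 1"
  shows "1 / (real n + 1) \<le> ln (real (Suc n)) - ln (real n)"
proof -
  have "ln (real n / real (Suc n)) \<le> real n / real (Suc n) - 1"
    using assms by (intro ln_le_minus_one) simp
  also have "\<dots> = - (1 / (real n + 1))"
    by (simp add: field_simps)
  finally show ?thesis
    using assms by (simp add: ln_div)
qed

text \<open>Induction on \<open>K\<close>: each step adds
  \<open>1 / (2 * K) + 1 / (2 * (K + 1))\<close> to the error, which is nonnegative and at most
  twice the increment of \<open>ln\<close>. At \<open>K = 2\<close> the sum is empty and the error
  is 3/4, which the constant 1 absorbs.\<close>

lemma weighted_sum_bounds:
  assumes "K \<ge> 2"
  shows "3/4 * (real K - 1) - (\<Sum>l = 2..K - 1. (real K - real l) / ((real l)\<^sup>2 - 1))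
    \<in> {0..1 + 2 * ln (real K)}"
  using assms
proof (induction K rule: dec_induct)
  case base
  show ?case by (auto intro: add_nonneg_nonneg)
next
  case (step K)
  let ?T = "\<lambda>K::nat. \<Sum>l = 2..K - 1. (real K - real l) / ((real l)\<^sup>2 - 1)"
  \<comment> \<open>The summand at \<open>l = K\<close> vanishes, so \<open>?T K\<close> may be
    taken over the range of \<open>?T (Suc K)\<close> and subtracted termwise.\<close>
  have "{2..K} = insert K {2..K - 1}"
    using step by auto
  then have "?T K = (\<Sum>l = 2..K. (real K - real l) / ((real l)\<^sup>2 - 1))"
    using step by simp
  then have "?T (Suc K) - ?T K = (\<Sum>l = 2..K. 1 / ((real l)\<^sup>2 - 1))"
    by (simp add: sum_subtractf [symmetric] diff_divide_distrib [symmetric])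
  also have "\<dots> = 3/4 - 1 / (2 * real K) - 1 / (2 * (real K + 1))"
    using step by (intro sum_inverse_square_minus_one) simp
  finally have increment: "?T (Suc K) - ?T K = 3/4 - 1 / (2 * real K) - 1 / (2 * (real K + 1))" .
  have "1 / (2 * real K) \<le> 1 / (real K + 1)" "1 / (2 * (real K + 1)) \<le> 1 / (real K + 1)"
    using step by (intro frac_le; simp)+
  then have "1 / (2 * real K) + 1 / (2 * (real K + 1)) \<le> 2 * (1 / (real K + 1))"
    by simp
  also have "\<dots> \<le> 2 * (ln (real (Suc K)) - ln (real K))"
    using step by (intro mult_left_mono one_div_Suc_le_ln_diff) auto
  finally have "1 / (2 * real K) + 1 / (2 * (real K + 1)) \<le> 2 * (ln (real (Suc K)) - ln (real K))" .
  moreover have "0 \<le> 1 / (2 * real K) + 1 / (2 * (real K + 1))"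
    by simp
  moreover have "3/4 * (real (Suc K) - 1) - ?T (Suc K)
      = 3/4 * (real K - 1) - ?T K + (1 / (2 * real K) + 1 / (2 * (real K + 1)))"
    using increment unfolding of_nat_Suc by argo
  ultimately show ?case
    using step.IH unfolding atLeastAtMost_iff by argo
qed

lemma Ord_tendsto: "Ord \<longlonglongrightarrow> 4"
proof -
  let ?T = "\<lambda>K::nat. \<Sum>l = 2..K - 1. (real K - real l) / ((real l)\<^sup>2 - 1)"
  let ?D = "\<lambda>K. 3/4 * (real K - 1) - ?T K"
  have "(\<lambda>K. ?D K / (real K - 1)) \<longlonglongrightarrow> 0"
  proof (rule tendsto_sandwich)
    show "\<forall>\<^sub>F K in sequentially. 0 \<le> ?D K / (real K - 1)"
      using eventually_ge_at_top [of "2::nat"]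
      by eventually_elim (rule divide_nonneg_nonneg, use weighted_sum_bounds in auto)
    show "\<forall>\<^sub>F K in sequentially. ?D K / (real K - 1) \<le> 2 * (1 / real K + 2 * (ln (real K) / real K))"
      using eventually_ge_at_top [of "2::nat"]
    proof eventually_elim
      case (elim K)
      \<comment> \<open>For \<open>K \<ge> 2\<close>, \<open>K - 1 \<ge> K / 2\<close>.\<close>
      have "?D K / (real K - 1) \<le> (1 + 2 * ln (real K)) / (real K / 2)"
        using elim weighted_sum_bounds [OF elim] by (intro frac_le) auto
      also have "\<dots> = 2 * (1 / real K + 2 * (ln (real K) / real K))"
        by (simp add: add_divide_distrib)
      finally show ?case .
    qed
    have "(\<lambda>K. ln (real K) / real K) \<longlonglongrightarrow> 0"
      by (rule filterlim_compose [OF ln_x_over_x_tendsto_0 filterlim_real_sequentially])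
    then have "(\<lambda>K. 2 * (1 / real K + 2 * (ln (real K) / real K))) \<longlonglongrightarrow> 2 * (0 + 2 * 0)"
      by (intro tendsto_intros lim_1_over_n)
    then show "(\<lambda>K. 2 * (1 / real K + 2 * (ln (real K) / real K))) \<longlonglongrightarrow> 0"
      by simp
  qed simp
  \<comment> \<open>The bracket in \<open>Ord\<close> is \<open>1 - ?T K / (K - 1)\<close>, that is,
    1/4 plus the normalized error.\<close>
  then have "(\<lambda>K. inverse (1/4 + ?D K / (real K - 1))) \<longlonglongrightarrow> inverse (1/4 + 0)"
    by (intro tendsto_intros) auto
  moreover have "\<forall>\<^sub>F K in sequentially. inverse (1/4 + ?D K / (real K - 1)) = Ord K"
    using eventually_ge_at_top [of "2::nat"]
  proof eventually_elim
    case (elim K)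
    then have "real K - 1 \<noteq> 0"
      by simp
    then have "?D K / (real K - 1) = 3/4 - ?T K / (real K - 1)"
      by (simp only: diff_divide_distrib [of _ "?T K"] nonzero_mult_div_cancel_right not_False_eq_True)
    then show ?case
      by (simp add: Ord_def)
  qed
  ultimately show ?thesis
    using Lim_transform_eventually by fastforce
qed

text \<open>Fixing \<open>m\<close> separates the limit from the rounding.\<close>

lemma dof_term_tendsto:
  assumes "1 + real_of_int m * (real_of_int m - 1) / 4 \<noteq> 0"
  shows "(\<lambda>K. dof_term K m) \<longlonglongrightarrow>
    (real_of_int m)\<^sup>2 / (1 + real_of_int m * (real_of_int m - 1) / 4)"
  unfolding dof_term_def using assms by (intro tendsto_intros Ord_tendsto) auto

lemma floor_ceiling_near_8:
  assumes "7 < x" "x < (9::real)"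
  shows "\<lfloor>x\<rfloor> = 8 \<and> \<lceil>x\<rceil> \<in> {8, 9} \<or> \<lfloor>x\<rfloor> \<in> {7, 8} \<and> \<lceil>x\<rceil> = 8"
proof (cases "x \<ge> 8")
  case True
  then have "\<lfloor>x\<rfloor> = 8" using assms by linarith
  moreover have "\<lceil>x\<rceil> = 8 \<or> \<lceil>x\<rceil> = 9" using True assms by linarith
  ultimately show ?thesis by blast
next
  case False
  then have "\<lfloor>x\<rfloor> = 7" "\<lceil>x\<rceil> = 8" using assms by linarith+
  then show ?thesis by blast
qed

theorem mainTheorem2:
  shows "d_s \<longlonglongrightarrow> 64 / 15"
proof -
  have lim7: "(\<lambda>K. dof_term K 7) \<longlonglongrightarrow> 98 / 23"
    and lim8: "(\<lambda>K. dof_term K 8) \<longlonglongrightarrow> 64 / 15"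
    and lim9: "(\<lambda>K. dof_term K 9) \<longlonglongrightarrow> 81 / 19"
    using dof_term_tendsto [of 7] dof_term_tendsto [of 8] dof_term_tendsto [of 9] by simp_all
  have "\<forall>\<^sub>F K in sequentially. Ord K > 7/2" "\<forall>\<^sub>F K in sequentially. Ord K < 9/2"
    by (rule order_tendstoD [OF Ord_tendsto], simp)+
  \<comment> \<open>The threshold 4.265 separates 98/23 (about 4.2609) and 81/19 (about 4.2632) from
    64/15 (about 4.2667).\<close>
  moreover have "\<forall>\<^sub>F K in sequentially. dof_term K 7 < 4265/1000"
    "\<forall>\<^sub>F K in sequentially. dof_term K 8 > 4265/1000"
    "\<forall>\<^sub>F K in sequentially. dof_term K 9 < 4265/1000"
    by (rule order_tendstoD [OF lim7] order_tendstoD [OF lim8] order_tendstoD [OF lim9], simp)+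
  \<comment> \<open>One rounding is 8, and its term beats those of 7 and 9, so it is the
    maximum.\<close>
  ultimately have "\<forall>\<^sub>F K in sequentially. dof_term K 8 = d_s K"
  proof eventually_elim
    case (elim K)
    then show ?case
      using floor_ceiling_near_8 [of "2 * Ord K"]
      by (auto simp: d_s_def Ord1_def Ord2_def)
  qed
  with lim8 show ?thesis
    by (rule Lim_transform_eventually)
qed

end
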